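(* For every real $R>0$, one has $B_{\mathrm{gen}}(R)=B_{\mathrm{sc}}(R)=\frac12$, where $$B_{\mathrm{gen}}(R):=\inf\left\{Q(D_1,D_2;z): D_1,D_2\in\mathcal H_R,\ z\in D_1\cap D_2\right\},$$ $$B_{\mathrm{sc}}(R):=\inf\left\{Q(D_1,D_2;z): D_1,D_2\in\mathcal S_R,\ z\in D_1\cap D_2\right\},$$ $$Q(D_1,D_2;z):=\frac{\lambda_{D_1\cap D_2}(z)}{\lambda_{D_1}(z)+\lambda_{D_2}(z)}.$$ Moreover, in both classes $\mathcal H_R$ and $\mathcal S_R$ the infimum is attained, and for $D_1,D_2$ in the class and $z\in D_1\cap D_2$, the equality $Q(D_1,D_2;z)=\frac12$ holds if and only if $D_1=D_2$.
   Context: A domain is a nonempty connected open set. A domain $G\subset\mathbb C$ is hyperbolic if $\mathbb C\setminus G$ contains at least two points. For $R>0$, let $\mathbb D_R:=\{z\in\mathbb C:|z|<R\}$; $\mathcal H_R$ is the class of hyperbolic domains in $\mathbb C$ contained in $\mathbb D_R$ (every domain contained in $\mathbb D_R$ is hyperbolic), and $\mathcal S_R\subset\mathcal H_R$ is the subclass of simply connected domains. For a hyperbolic domain $G$, $\lambda_G$ denotes the density of its hyperbolic metric $\lambda_G(z)\,|dz|$, normalized by $\lambda_{\mathbb D}(z)=\frac{1}{1-|z|^2}$ on the unit disk $\mathbb D$; equivalently, $\lambda_G$ is the unique function with $\lambda_G(\pi(\zeta))\,|\pi'(\zeta)|=\lambda_{\mathbb D}(\zeta)$ for all $\zeta\in\mathbb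 D$, for a holomorphic universal covering map $\pi:\mathbb D\to G$. Convention: if $D_1\cap D_2$ is not connected and $z\in D_1\cap D_2$, then $\lambda_{D_1\cap D_2}(z)$ means the hyperbolic density at $z$ of the connected component of $D_1\cap D_2$ containing $z$. *)

theory Defs
  imports "HOL-Complex_Analysis.Complex_Analysis"
begin

definition plane_domain :: "complex set \<Rightarrow> bool" where
  "plane_domain G \<longleftrightarrow> G \<noteq> {} \<and> open G \<and> connected G"

definition hyperbolic_domain :: "complex set \<Rightarrow> bool" where
  "hyperbolic_domain G \<longleftrightarrow> plane_domain G \<and> (\<exists>a b. a \<noteq> b \<and> a \<notin> G \<and> b \<notin> G)"

(* The disk is simply connected, so every covering by it is universal. *)
definition holomorphic_universal_cover :: "(complex \<Rightarrow> complex) \<Rightarrow> complex set \<Rightarrow> bool" where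
  "holomorphic_universal_cover p G \<longleftrightarrow>
     p holomorphic_on ball 0 1 \<and> covering_space (ball 0 1) p G"

definition disk_density :: "complex \<Rightarrow> real" where
  "disk_density z = 1 / (1 - (norm z)\<^sup>2)"

definition is_hyperbolic_density :: "complex set \<Rightarrow> (complex \<Rightarrow> real) \<Rightarrow> bool" where
  "is_hyperbolic_density G l \<longleftrightarrow>
     (\<exists>p. holomorphic_universal_cover p G \<and>
          (\<forall>\<zeta>\<in>ball 0 1. l (p \<zeta>) * norm (deriv p \<zeta>) = disk_density \<zeta>))"

(* A density is determined only on G, so its value at z is selected, rather than the function;
   for z outside G the result is unspecified. *)
definition hyperbolic_density :: "complex set \<Rightarrow> complex \<Rightarrow> real" where
  "hyperbolic_density G z = (THE r. \<exists>l. is_hyperbolic_density G l \<and> l z = r)"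

definition hyperbolic_class :: "real \<Rightarrow> complex set set" where
  "hyperbolic_class R = {G. hyperbolic_domain G \<and> G \<subseteq> ball 0 R}"

definition sc_class :: "real \<Rightarrow> complex set set" where
  "sc_class R = {G \<in> hyperbolic_class R. simply_connected G}"

(* D1 \<inter> D2 may be disconnected; its density at z is that of the component containing z. *)
definition density_quotient :: "complex set \<Rightarrow> complex set \<Rightarrow> complex \<Rightarrow> real" where
  "density_quotient D1 D2 z =
     hyperbolic_density (connected_component_set (D1 \<inter> D2) z) z /
       (hyperbolic_density D1 z + hyperbolic_density D2 z)"

definition B_gen :: "real \<Rightarrow> real" where
  "B_gen R = Inf {density_quotient D1 D2 z | D1 D2 z.
     D1 \<in> hyperbolic_class R \<and> D2 \<in> hyperbolic_class R \<and> z \<in> D1 \<inter> D2}"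

definition B_sc :: "real \<Rightarrow> real" where
  "B_sc R = Inf {density_quotient D1 D2 z | D1 D2 z.
     D1 \<in> sc_class R \<and> D2 \<in> sc_class R \<and> z \<in> D1 \<inter> D2}"

end

theory Submission
  imports Defs
begin

text \<open>
  By the Schwarz--Pick lemma, applied to lifts through universal covers, the hyperbolic density
  does not increase when a domain grows, and it keeps its value at some point only if the domain
  does not change. Comparing the component of \<open>D1 \<inter> D2\<close> with \<open>D1\<close> and \<open>D2\<close> gives both the bound
  \<open>1/2\<close> and the equality case.

  The substance is the existence of a holomorphic universal cover of a bounded domain \<open>G\<close>. It is
  obtained by Koebe's square-root method: among the coverings \<open>p\<close> of \<open>G\<close> by open
  subsets \<open>U\<close> of the unit disk with \<open>p 0 = z0\<close>, take a sequence minimizing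
  \<open>\<bar>deriv p 0\<bar>\<close>. If \<open>U\<close> misses a point \<open>a\<close> of the disk, composing \<open>p\<close> with the two-sheeted self-map
  of the disk branched over \<open>a\<close> multiplies \<open>\<bar>deriv p 0\<bar>\<close> by \<open>2 * sqrt \<bar>a\<bar> / (1 + \<bar>a\<bar>) < 1\<close>.
  Hence the sets \<open>U\<close> exhaust the disk along the sequence, and by Montel's theorem a subsequence of
  the coverings, together with their local sections, converges to a covering by the whole disk.
\<close>

section \<open>Universal covers of bounded domains\<close>

lemma Moebius_function_0_has_field_derivative:
  assumes "norm w < 1" "norm z < 1"
  shows "(Moebius_function 0 w has_field_derivative
           of_real (1 - (norm w)\<^sup>2) / (1 - cnj w * z)\<^sup>2) (at z)"
proof -
  have "norm (cnj w * z) < 1"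
    using norm_mult_less[of "cnj w" 1 z 1] assms by simp
  then have nz: "1 - cnj w * z \<noteq> 0"
    by (metis eq_iff_diff_eq_0 norm_one order.irrefl)
  have "1 - cnj w * w = of_real (1 - (norm w)\<^sup>2)"
    by (simp add: complex_norm_square mult.commute flip: of_real_power)
  moreover have "((\<lambda>z. (z - w) / (1 - cnj w * z)) has_field_derivative
           (1 - cnj w * w) / (1 - cnj w * z)\<^sup>2) (at z)"
    by (rule derivative_eq_intros refl | use nz in \<open>simp add: power2_eq_square algebra_simps\<close>)+
  ultimately show ?thesis
    unfolding Moebius_function_def by simp
qed

lemma deriv_section:
  assumes "p holomorphic_on U" "open U" "s holomorphic_on B" "open B" "b \<in> B"
    and "s ` B \<subseteq> U" "\<And>c. c \<in> B \<Longrightarrow> p (s c) = c"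
  shows "deriv p (s b) * deriv s b = 1"
proof -
  have s: "(s has_field_derivative deriv s b) (at b)"
    using assms holomorphic_derivI by blast
  have "(p has_field_derivative deriv p (s b)) (at (s b))"
    using assms by (meson holomorphic_derivI image_subset_iff)
  then have "((\<lambda>c. p (s c)) has_field_derivative deriv p (s b) * deriv s b) (at b)"
    using DERIV_chain2 s by blast
  moreover have "((\<lambda>c. p (s c)) has_field_derivative 1) (at b)"
    using assms by (intro has_field_derivative_transform_within_open[OF DERIV_ident]) auto
  ultimately show ?thesis
    by (rule DERIV_unique)
qed

text \<open>A covering property that never mentions connectedness of \<open>U\<close>, so that it passes to the full
  preimage of \<open>U\<close> under a branched cover of the disk, and that survives locally uniform limits.\<close>

definition lifts_discs :: "(complex \<Rightarrow> complex) \<Rightarrow> complex set \<Rightarrow> complex set \<Rightarrow> bool" where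
  "lifts_discs p U G \<longleftrightarrow> p holomorphic_on U \<and> p ` U \<subseteq> G \<and>
     (\<forall>w e z. ball w e \<subseteq> G \<longrightarrow> z \<in> U \<longrightarrow> p z \<in> ball w e \<longrightarrow>
       (\<exists>s. s holomorphic_on ball w e \<and> s ` ball w e \<subseteq> U \<and> s (p z) = z \<and>
            (\<forall>b\<in>ball w e. p (s b) = b)))"

section \<open>Koebe's square-root method\<close>

lemma lifts_discsE:
  assumes "lifts_discs p U G" "ball w e \<subseteq> G" "z \<in> U" "p z \<in> ball w e"
  obtains s where "s holomorphic_on ball w e" "s ` ball w e \<subseteq> U" "s (p z) = z"
    "\<And>b. b \<in> ball w e \<Longrightarrow> p (s b) = b"
  using assms unfolding lifts_discs_def by metis

text \<open>The section through 0, rescaled to the unit disk, is a self-map fixing 0, so the Schwarz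
  lemma bounds its derivative. This keeps the infimum in the extremal problem positive.\<close>

lemma lifts_discs_deriv_lower_bound:
  assumes p: "lifts_discs p U G" and U: "open U" "U \<subseteq> ball 0 1" "0 \<in> U"
    and e: "e > 0" "ball (p 0) e \<subseteq> G"
  shows "e \<le> norm (deriv p 0)"
proof -
  obtain s where s: "s holomorphic_on ball (p 0) e" "s ` ball (p 0) e \<subseteq> U" "s (p 0) = 0"
    "\<And>b. b \<in> ball (p 0) e \<Longrightarrow> p (s b) = b"
    using lifts_discsE[OF p e(2) U(3)] e by auto
  define f where "f z = s (p 0 + of_real e * z)" for z
  have im: "p 0 + of_real e * z \<in> ball (p 0) e" if "z \<in> ball 0 1" for z
    using that e by (simp add: dist_norm norm_mult)
  have hol: "f holomorphic_on ball 0 1"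
    unfolding f_def using im
    by (intro holomorphic_on_compose_gen[OF _ s(1), unfolded o_def] holomorphic_intros) auto
  have "norm (deriv f 0) \<le> 1"
  proof (rule Schwarz_Lemma(2)[OF hol, of 0])
    show "f 0 = 0" by (simp add: f_def s)
    show "norm (f z) < 1" if "norm z < 1" for z
      using im[of z] s(2) U(2) that unfolding f_def by (force simp: image_subset_iff)
  qed auto
  moreover have "(s has_field_derivative deriv s (p 0)) (at (p 0 + of_real e * 0))"
    using s e holomorphic_derivI[OF s(1)] by simp
  then have "(f has_field_derivative deriv s (p 0) * of_real e) (at 0)"
    unfolding f_def by (rule DERIV_chain2) (auto intro!: derivative_eq_intros)
  then have "deriv f 0 = deriv s (p 0) * of_real e"
    by (rule DERIV_imp_deriv)
  moreover have "deriv p 0 * deriv s (p 0) = 1"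
    using deriv_section[of p U s "ball (p 0) e" "p 0"] p s U e
    by (auto simp: lifts_discs_def)
  then have "norm (deriv p 0) * norm (deriv s (p 0)) = 1"
    by (metis norm_mult norm_one)
  ultimately have "norm (deriv s (p 0)) * e \<le> norm (deriv p 0) * norm (deriv s (p 0))"
    using e by (simp add: norm_mult)
  then show ?thesis
    using \<open>norm (deriv p 0) * norm (deriv s (p 0)) = 1\<close>
    by (metis mult.commute mult_le_cancel_left_pos mult_zero_right norm_ge_zero order_le_less zero_neq_one)
qed

text \<open>Sections of \<open>p\<close> avoid \<open>a\<close>, and discs are simply connected, so
  a holomorphic square root carries these sections through the two-sheeted map branched over
  \<open>a\<close>. The derivative changes by the derivative of that map at 0.\<close>

lemma lifts_discs_sqrt_step:
  assumes p: "lifts_discs p U G" and U: "open U" "U \<subseteq> ball 0 1" "0 \<in> U"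
    and a: "norm a < 1" "a \<notin> U"
  obtains U' p' where "lifts_discs p' U' G" "open U'" "U' \<subseteq> ball 0 1" "0 \<in> U'" "p' 0 = p 0"
    "norm (deriv p' 0) * (1 + norm a) = norm (deriv p 0) * (2 * sqrt (norm a))"
proof -
  let ?M = "Moebius_function 0"
  \<comment> \<open>Any square root of \<open>- a\<close> serves: \<open>?M (-b)\<close> sends 0 to
    \<open>b\<close>, squaring gives \<open>- a\<close>, and \<open>?M (-a)\<close> sends this back
    to 0. The critical point \<open>- b\<close> is sent to \<open>a\<close>.\<close>
  define b where "b = csqrt (- a)"
  have bb: "b\<^sup>2 = - a" by (simp add: b_def)
  have nb: "norm b = sqrt (norm a)"
    using bb by (metis norm_minus_cancel norm_power norm_ge_zero real_sqrt_unique)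
  then have b1: "norm b < 1" using a by simp
  have M1: "norm (?M w z) < 1" if "norm w < 1" "norm z < 1" for w z
    using that by (rule Moebius_function_norm_lt_1)
  have hol: "?M w holomorphic_on ball 0 1" if "norm w < 1" for w
    using that by (rule Moebius_function_holomorphic)
  \<comment> \<open>the two-sheeted self-map of the disk that fixes 0 and branches only over \<open>a\<close>\<close>
  define s where "s z = ?M (-a) ((?M (-b) z)\<^sup>2)" for z
  have sq1: "norm (z\<^sup>2) < 1" if "norm z < 1" for z :: complex
    using that by (simp add: norm_power power_less_one_iff)
  have s1: "norm (s z) < 1" if "norm z < 1" for z
    unfolding s_def using that a b1 by (intro M1 sq1) auto
  have s0: "s 0 = 0"
    by (simp add: s_def Moebius_function_simple bb)
  have hols: "s holomorphic_on ball 0 1"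
    unfolding s_def using a b1 M1 sq1
    by (intro holomorphic_on_compose_gen[OF _ hol, unfolded o_def] holomorphic_intros hol) auto
  have sq: "((\<lambda>z. (?M (-b) z)\<^sup>2) has_field_derivative 2 * b * of_real (1 - (norm b)\<^sup>2)) (at 0)"
    using Moebius_function_0_has_field_derivative[of "-b" 0] b1
    by (auto intro!: derivative_eq_intros simp: Moebius_function_simple complex_norm_square[symmetric, simplified])
  have "(?M (-a) has_field_derivative
      of_real (1 - (norm a)\<^sup>2) / (1 - cnj a * a)\<^sup>2) (at ((?M (-b) 0)\<^sup>2))"
    using Moebius_function_0_has_field_derivative[of "-a" "-a"] a bb
    by (simp add: Moebius_function_simple)
  from DERIV_chain2[OF this sq] have ds: "(s has_field_derivative
     of_real (1 - (norm a)\<^sup>2) / (1 - cnj a * a)\<^sup>2 * (2 * b * of_real (1 - (norm b)\<^sup>2))) (at 0)"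
    unfolding s_def .
  have "1 - cnj a * a = of_real (1 - (norm a)\<^sup>2)"
    by (simp add: complex_norm_square mult.commute flip: of_real_power)
  moreover have n2: "(norm b)\<^sup>2 = norm a" by (simp add: nb)
  moreover have "1 - (norm a)\<^sup>2 = (1 - norm a) * (1 + norm a)"
    by (simp add: power2_eq_square algebra_simps)
  \<comment> \<open>One factor \<open>1 - norm a\<close> of \<open>1 - (norm a)\<^sup>2\<close>
    cancels against \<open>1 - (norm b)\<^sup>2\<close>, leaving \<open>1 + norm a\<close>.\<close>
  ultimately have ds': "norm (deriv s 0) * (1 + norm a) = 2 * sqrt (norm a)"
    using a n2 add_pos_nonneg[OF zero_less_one norm_ge_zero[of a]] unfolding DERIV_imp_deriv[OF ds]
    by (simp add: norm_mult norm_divide norm_power nb power2_eq_square divide_simps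
             del: of_real_mult of_real_diff of_real_add of_real_power)
  define U' where "U' = ball 0 1 \<inter> s -` U"
  define p' where "p' = p \<circ> s"
  have holp: "p holomorphic_on U" and pU: "p ` U \<subseteq> G"
    using p by (auto simp: lifts_discs_def)
  have "lifts_discs p' U' G"
    unfolding lifts_discs_def
  proof (intro conjI allI impI)
    show "p' holomorphic_on U'"
      unfolding p'_def
      by (rule holomorphic_on_compose_gen[OF holomorphic_on_subset[OF hols] holp])
        (auto simp: U'_def)
    show "p' ` U' \<subseteq> G"
      using pU by (auto simp: p'_def U'_def)
    fix w e z assume B: "ball w e \<subseteq> G" and z: "z \<in> U'" "p' z \<in> ball w e"
    then have "s z \<in> U" "p (s z) \<in> ball w e" and z1: "norm z < 1"
      by (auto simp: U'_def p'_def)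
    then obtain t where t: "t holomorphic_on ball w e" "t ` ball w e \<subseteq> U" "t (p (s z)) = s z"
      "\<And>c. c \<in> ball w e \<Longrightarrow> p (t c) = c"
      using lifts_discsE[OF p B] by metis
    have tc: "norm (t c) < 1" if "c \<in> ball w e" for c
      using t(2) U(2) that by force
    have MM: "?M (-w) (?M w x) = x" if "norm w < 1" "norm x < 1" for w x
      using that by (intro Moebius_function_compose) auto
    \<comment> \<open>The only zero of \<open>?M a\<close> in the disk is \<open>a\<close>, which
      \<open>t\<close> avoids since its values lie in \<open>U\<close>. This is what makes the
      square root available.\<close>
    have nz: "?M a (t c) \<noteq> 0" if "c \<in> ball w e" for c
    proof
      assume "?M a (t c) = 0"
      then have "?M (-a) (?M a (t c)) = a" by (simp only: Moebius_function_simple) simp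
      then have "t c = a" using MM[of a "t c"] a tc[OF that] by simp
      then show False using a t(2) that by blast
    qed
    have "(\<lambda>c. ?M a (t c)) holomorphic_on ball w e"
      using tc a by (intro holomorphic_on_compose_gen[OF t(1) hol, unfolded o_def]) auto
    moreover have "simply_connected (ball w e)"
      by (simp add: convex_imp_simply_connected)
    ultimately obtain g where g: "g holomorphic_on ball w e"
      "\<And>c. c \<in> ball w e \<Longrightarrow> ?M a (t c) = (g c)\<^sup>2"
      using nz simply_connected_eq_holomorphic_sqrt[of "ball w e"] by auto
    have "(g (p (s z)))\<^sup>2 = (?M (-b) z)\<^sup>2"
    proof -
      have "(g (p (s z)))\<^sup>2 = ?M a (s z)"
        using g(2)[of "p (s z)"] \<open>p (s z) \<in> ball w e\<close> t(3) by simp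
      also have "\<dots> = (?M (-b) z)\<^sup>2"
        unfolding s_def using a b1 z1 M1[of "-b" z] sq1[of "?M (-b) z"] MM[of "-a"] by simp
      finally show ?thesis .
    qed
    \<comment> \<open>The root is determined up to sign; the sign is chosen so that the new section
      passes through the prescribed point \<open>z\<close>.\<close>
    then consider "g (p (s z)) = ?M (-b) z" | "- g (p (s z)) = ?M (-b) z"
      by (metis minus_minus power2_eq_iff)
    then obtain h where h: "h holomorphic_on ball w e"
      "\<And>c. c \<in> ball w e \<Longrightarrow> ?M a (t c) = (h c)\<^sup>2" "h (p (s z)) = ?M (-b) z"
    proof cases
      case 1 then show ?thesis using g that by blast
    next
      case 2 then show ?thesis using g that[of "\<lambda>c. - g c"] by (auto intro: holomorphic_intros)
    qed
    have hc: "norm (h c) < 1" if "c \<in> ball w e" for c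
    proof -
      have "norm ((h c)\<^sup>2) < 1"
        using M1[OF a(1) tc[OF that]] h(2)[OF that] by simp
      then show ?thesis by (simp add: norm_power power_less_one_iff)
    qed
    show "\<exists>t. t holomorphic_on ball w e \<and> t ` ball w e \<subseteq> U' \<and> t (p' z) = z \<and>
            (\<forall>c\<in>ball w e. p' (t c) = c)"
    proof (intro exI[of _ "\<lambda>c. ?M b (h c)"] conjI ballI)
      have sc: "s (?M b (h c)) = t c" if "c \<in> ball w e" for c
        using MM[of b "h c"] MM[of a "t c"] h(2)[OF that] hc[OF that] b1 a tc[OF that]
        by (simp add: s_def)
      show "(\<lambda>c. ?M b (h c)) holomorphic_on ball w e"
        using hc b1 by (intro holomorphic_on_compose_gen[OF h(1) hol, unfolded o_def]) auto
      show "(\<lambda>c. ?M b (h c)) ` ball w e \<subseteq> U'"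
        using sc t(2) hc b1 M1 by (auto simp: U'_def)
      show "?M b (h (p' z)) = z"
        using h(3) MM[of "-b" z] b1 z1 by (simp add: p'_def)
      show "p' (?M b (h c)) = c" if "c \<in> ball w e" for c
        using sc t(4) that by (simp add: p'_def)
    qed
  qed
  moreover have "open U'"
    unfolding U'_def using hols U(1)
    by (simp add: continuous_open_preimage holomorphic_on_imp_continuous_on)
  moreover have "norm (deriv p' 0) * (1 + norm a) = norm (deriv p 0) * (2 * sqrt (norm a))"
  proof -
    have "(p has_field_derivative deriv p (s 0)) (at (s 0))"
      using holomorphic_derivI[OF holp] U s0 by simp
    from DERIV_chain2[OF this ds] have "deriv p' 0 = deriv p (s 0) * deriv s 0"
      unfolding p'_def o_def DERIV_imp_deriv[OF ds] by (rule DERIV_imp_deriv)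
    then show ?thesis using ds' s0 by (simp add: norm_mult mult.assoc)
  qed
  ultimately show thesis
    using that[of p' U'] s0 U(3) by (auto simp: U'_def p'_def)
qed

text \<open>This is monotonicity of \<open>sqrt x / (1 + x)\<close> on the unit interval, cleared of
  denominators: the gain of a square-root step is smallest for omitted points near the
  circle.\<close>

lemma sqrt_over_one_plus_le:
  fixes x y :: real
  assumes "0 \<le> x" "x \<le> y" "y \<le> 1"
  shows "sqrt x * (1 + y) \<le> sqrt y * (1 + x)"
proof -
  have "sqrt x \<le> sqrt y" "sqrt y \<le> 1" "0 \<le> sqrt x" using assms by auto
  then have "0 \<le> (sqrt y - sqrt x) * (1 - sqrt x * sqrt y)"
    by (intro mult_nonneg_nonneg) (auto simp: mult_le_one)
  also have "\<dots> = sqrt y * (1 + (sqrt x)\<^sup>2) - sqrt x * (1 + (sqrt y)\<^sup>2)"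
    by (simp add: algebra_simps power2_eq_square)
  finally show ?thesis using assms by simp
qed

text \<open>If \<open>\<bar>deriv p 0\<bar>\<close> is close enough to its infimum, a point \<open>a\<close> of \<open>ball 0 r - U\<close> would allow
  a square-root step that undercuts the infimum.\<close>

lemma exists_lifts_discs_subdisc:
  assumes G: "open G" "bounded G" "z0 \<in> G" and r: "0 < r" "r < 1"
  shows "\<exists>p U. lifts_discs p U G \<and> open U \<and> U \<subseteq> ball 0 1 \<and> ball 0 r \<subseteq> U \<and> p 0 = z0"
proof -
  define X where "X = {norm (deriv p 0) | p U.
    lifts_discs p U G \<and> open U \<and> U \<subseteq> ball 0 1 \<and> 0 \<in> U \<and> p 0 = z0}"
  obtain e where e: "e > 0" "ball z0 e \<subseteq> G"
    using G openE by blast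
  have lb: "e \<le> x" if "x \<in> X" for x
    using that lifts_discs_deriv_lower_bound e by (fastforce simp: X_def)
  obtain R where R: "R > 0" "G \<subseteq> ball 0 R"
    using bounded_subset_ballD[OF G(2)] by blast
  have "X \<noteq> {}"
  proof -
    \<comment> \<open>A competitor for the extremal problem: an affine chart. The factor
      \<open>2 * R\<close> bounds the distance between two points of \<open>G\<close>, so the
      preimage of \<open>G\<close> lies in the unit disk.\<close>
    define p where "p u = z0 + of_real (2 * R) * u" for u :: complex
    have "continuous_on UNIV p" unfolding p_def by (intro continuous_intros)
    then have op: "open (p -` G)"
      using G(1) by (simp add: open_vimage)
    moreover have "p -` G \<subseteq> ball 0 1"
    proof
      fix u assume "u \<in> p -` G"
      then have "norm (p u) < R" "norm z0 < R" using R G by auto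
      then have "norm (p u - z0) < 2 * R" by norm
      then show "u \<in> ball 0 1" using R by (simp add: p_def norm_mult)
    qed
    moreover have "lifts_discs p (p -` G) G"
      unfolding lifts_discs_def
    proof (intro conjI allI impI)
      show "p holomorphic_on p -` G" unfolding p_def by (intro holomorphic_intros)
      fix w d z assume "ball w d \<subseteq> G" "z \<in> p -` G" "p z \<in> ball w d"
      then show "\<exists>s. s holomorphic_on ball w d \<and> s ` ball w d \<subseteq> p -` G \<and> s (p z) = z \<and>
            (\<forall>b\<in>ball w d. p (s b) = b)"
        using R
        by (intro exI[of _ "\<lambda>b. (b - z0) / of_real (2 * R)"] conjI holomorphic_intros)
          (auto simp: p_def)
    qed auto
    moreover have "p 0 = z0" by (simp add: p_def)
    ultimately show ?thesis using G(3) unfolding X_def by blast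
  qed
  have bdd: "bdd_below X" using lb by (auto simp: bdd_below_def)
  define m where "m = Inf X"
  have "e \<le> m" unfolding m_def using \<open>X \<noteq> {}\<close> lb by (rule cInf_greatest)
  have mle: "m \<le> x" if "x \<in> X" for x
    unfolding m_def using that bdd by (rule cInf_lower)
  \<comment> \<open>Strict inequality between the arithmetic and geometric means of 1 and
    \<open>r\<close> puts the threshold \<open>m * (1 + r) / (2 * sqrt r)\<close> strictly above the
    infimum \<open>m\<close>.\<close>
  have "0 \<noteq> (1 - sqrt r)\<^sup>2" using r by auto
  then have "0 < (1 - sqrt r)\<^sup>2" by (simp add: less_le)
  then have r': "2 * sqrt r < 1 + r" using r by (simp add: power2_eq_square algebra_simps)
  then have "m * (2 * sqrt r) < m * (1 + r)" using \<open>e \<le> m\<close> e by simp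
  then have "Inf X < m * (1 + r) / (2 * sqrt r)"
    using r by (simp add: field_simps m_def)
  then obtain x where x: "x \<in> X" "x < m * (1 + r) / (2 * sqrt r)"
    using cInf_lessD[OF \<open>X \<noteq> {}\<close>] by blast
  then obtain p U where p: "lifts_discs p U G" "p 0 = z0" "x = norm (deriv p 0)"
    and U: "open U" "U \<subseteq> ball 0 1" "0 \<in> U"
    unfolding X_def by blast
  have "ball 0 r \<subseteq> U"
  proof (rule ccontr)
    assume "\<not> ball 0 r \<subseteq> U"
    then obtain a where a: "norm a < r" "a \<notin> U" by (auto simp: subset_iff)
    obtain p' U' where "lifts_discs p' U' G" "open U'" "U' \<subseteq> ball 0 1" "0 \<in> U'" "p' 0 = p 0"
      and d: "norm (deriv p' 0) * (1 + norm a) = x * (2 * sqrt (norm a))"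
      using lifts_discs_sqrt_step[OF p(1) U, of a] a r p(3) by (metis order.strict_trans)
    then have "m \<le> norm (deriv p' 0)"
      using p(2) by (intro mle) (auto simp: X_def)
    then have "m * (1 + norm a) \<le> x * (2 * sqrt (norm a))"
      using d by (metis add_nonneg_nonneg mult_right_mono norm_ge_zero zero_le_one)
    \<comment> \<open>The extra factor \<open>1 + r\<close> prepares the comparison of
      \<open>norm a\<close> with \<open>r\<close> by \<open>sqrt_over_one_plus_le\<close>.\<close>
    then have "m * (1 + norm a) * (1 + r) \<le> x * (2 * sqrt (norm a)) * (1 + r)"
      using r by (simp add: mult_right_mono)
    also have "\<dots> = 2 * x * (sqrt (norm a) * (1 + r))" by simp
    also have "\<dots> \<le> 2 * x * (sqrt r * (1 + norm a))"
      using a r lb[OF x(1)] e by (intro mult_left_mono sqrt_over_one_plus_le) auto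
    also have "\<dots> = x * (2 * sqrt r) * (1 + norm a)" by simp
    also have "\<dots> < m * (1 + r) * (1 + norm a)"
      using x(2) r by (intro mult_strict_right_mono) (auto simp: field_simps add_pos_nonneg)
    finally show False by (simp add: ac_simps)
  qed
  then show ?thesis using p U by blast
qed

section \<open>Limits of coverings and of their sections\<close>

text \<open>Used for composites \<open>f n (x n)\<close> in which both the map and the point vary,
  so that the identities between coverings and sections pass to the limit.\<close>

lemma tendsto_uniform_limit_cball:
  fixes f :: "'i \<Rightarrow> 'a::metric_space \<Rightarrow> 'b::metric_space"
  assumes f: "uniform_limit (cball c d) f g F" and g: "continuous_on (cball c d) g"
    and x: "(x \<longlongrightarrow> c) F" and d: "d > 0"
  shows "((\<lambda>n. f n (x n)) \<longlongrightarrow> g c) F"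
proof (rule tendstoI)
  fix e :: real assume e: "e > 0"
  have xc: "eventually (\<lambda>n. x n \<in> cball c d) F"
    using tendstoD[OF x d] by eventually_elim (simp add: dist_commute)
  have "((\<lambda>n. g (x n)) \<longlongrightarrow> g c) F"
    using continuous_on_tendsto_compose[OF g x _ xc] d by simp
  then have "eventually (\<lambda>n. dist (g (x n)) (g c) < e / 2) F"
    by (rule tendstoD) (use e in auto)
  moreover have "eventually (\<lambda>n. \<forall>y\<in>cball c d. dist (f n y) (g y) < e / 2) F"
    using f e by (intro uniform_limitD) auto
  ultimately show "eventually (\<lambda>n. dist (f n (x n)) (g c) < e) F"
    using xc by eventually_elim (metis dist_commute dist_triangle_half_r)
qed

text \<open>Montel's theorem is applied twice: once to the coverings, and then, for each disc and
  starting point, to their sections. The limits of the sections are sections of the limit.\<close>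

lemma exists_lifts_discs_disc:
  assumes G: "open G" "bounded G" "z0 \<in> G"
  obtains p where "lifts_discs p (ball 0 1) G" "p 0 = z0"
proof -
  \<comment> \<open>The double \<open>Suc\<close> makes the radii positive from the start, with
    first value 1/2.\<close>
  define \<rho> where "\<rho> n = real (Suc n) / real (Suc (Suc n))" for n
  have \<rho>: "0 < \<rho> n" "\<rho> n < 1" for n
    by (auto simp: \<rho>_def)
  have \<rho>1: "\<rho> \<longlonglongrightarrow> 1"
    unfolding \<rho>_def by (rule LIMSEQ_Suc[OF LIMSEQ_n_over_Suc_n])
  obtain P U where P: "\<And>n. lifts_discs (P n) (U n) G" "\<And>n. P n 0 = z0"
    and U: "\<And>n. open (U n)" "\<And>n. U n \<subseteq> ball 0 1" "\<And>n. ball 0 (\<rho> n) \<subseteq> U n"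
    using exists_lifts_discs_subdisc[OF G \<rho>] by metis
  obtain R where R: "R > 0" "G \<subseteq> ball 0 R"
    using bounded_subset_ballD[OF G(2)] by blast
  \<comment> \<open>Shrinking the argument defines every map on the whole unit disk, giving one
    family with values in the bounded set \<open>G\<close>.\<close>
  define F where "F n z = P n (of_real (\<rho> n) * z)" for n z
  have \<rho>U: "of_real (\<rho> n) * z \<in> U n" if "z \<in> ball 0 1" for n z
    using U(3)[of n] that \<rho>[of n] by (force simp: norm_mult)
  have holP: "P n holomorphic_on U n" and PU: "P n ` U n \<subseteq> G" for n
    using P by (auto simp: lifts_discs_def)
  have holF: "F n holomorphic_on ball 0 1" for n
    unfolding F_def
    by (intro holomorphic_on_compose_gen[OF _ holP, unfolded o_def] holomorphic_intros)
      (use \<rho>U in auto)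
  have FG: "F n z \<in> G" if "z \<in> ball 0 1" for n z
    using PU \<rho>U[OF that] unfolding F_def by blast
  obtain p k where holp: "p holomorphic_on ball 0 1" and k: "strict_mono (k :: nat \<Rightarrow> nat)"
    and lim: "\<And>x. x \<in> ball 0 1 \<Longrightarrow> (\<lambda>n. F (k n) x) \<longlonglongrightarrow> p x"
    and ulim: "\<And>K. compact K \<Longrightarrow> K \<subseteq> ball 0 1 \<Longrightarrow> uniform_limit K (F \<circ> k) p sequentially"
  proof (rule Montel[of "ball 0 1" "range F" F])
    show "\<exists>B. \<forall>h\<in>range F. \<forall>z\<in>K. norm (h z) \<le> B" if "compact K" "K \<subseteq> ball 0 1" for K
      using FG R that by (intro exI[of _ R]) (force intro: less_imp_le)
  qed (use holF in auto)
  have \<rho>k: "(\<lambda>n. \<rho> (k n)) \<longlonglongrightarrow> 1"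
    using LIMSEQ_subseq_LIMSEQ[OF \<rho>1 k] by (simp add: o_def)
  have sec: "\<exists>s. s holomorphic_on ball w e \<and> s ` ball w e \<subseteq> ball 0 1 \<and> s (p z) = z \<and>
            (\<forall>b\<in>ball w e. p (s b) = b)"
    if B: "ball w e \<subseteq> G" and z: "z \<in> ball 0 1" and pz: "p z \<in> ball w e" for w e z
  proof -
    have "eventually (\<lambda>n. F (k n) z \<in> ball w e) sequentially"
      using lim[OF z] pz topological_tendstoD open_ball by blast
    \<comment> \<open>Dropping the first \<open>N\<close> terms provides a section through the
      shrunken point for every remaining index.\<close>
    then obtain N where N: "\<And>n. F (k (n + N)) z \<in> ball w e"
      unfolding eventually_sequentially by (metis le_add2)
    define j where "j n = k (n + N)" for n
    have "\<exists>s. s holomorphic_on ball w e \<and> s ` ball w e \<subseteq> U (j n) \<and>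
              s (F (j n) z) = of_real (\<rho> (j n)) * z \<and> (\<forall>b\<in>ball w e. P (j n) (s b) = b)" for n
      using lifts_discsE[OF P(1) B \<rho>U[OF z]] N by (metis F_def j_def)
    then obtain S where holS: "\<And>n. S n holomorphic_on ball w e"
      and SU: "\<And>n. S n ` ball w e \<subseteq> U (j n)"
      and Sz: "\<And>n. S n (F (j n) z) = of_real (\<rho> (j n)) * z"
      and PS: "\<And>n b. b \<in> ball w e \<Longrightarrow> P (j n) (S n b) = b"
      by metis
    have S1: "norm (S n b) < 1" if "b \<in> ball w e" for n b
      using SU U(2) that by (fastforce simp: image_subset_iff)
    obtain s l where hols: "s holomorphic_on ball w e" and l: "strict_mono (l :: nat \<Rightarrow> nat)"
      and lims: "\<And>x. x \<in> ball w e \<Longrightarrow> (\<lambda>n. S (l n) x) \<longlonglongrightarrow> s x"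
      and ulims: "\<And>K. compact K \<Longrightarrow> K \<subseteq> ball w e \<Longrightarrow> uniform_limit K (S \<circ> l) s sequentially"
    proof (rule Montel[of "ball w e" "range S" S])
      show "\<exists>B. \<forall>h\<in>range S. \<forall>z\<in>K. norm (h z) \<le> B" if "compact K" "K \<subseteq> ball w e" for K
        using S1 that by (intro exI[of _ 1]) (force intro: less_imp_le)
    qed (use holS in auto)
    have jl: "strict_mono (\<lambda>n. l n + N)"
      using l by (simp add: strict_mono_def)
    have Fjl: "(\<lambda>n. F (j (l n)) x) \<longlonglongrightarrow> p x" if "x \<in> ball 0 1" for x
      using LIMSEQ_subseq_LIMSEQ[OF lim[OF that] jl] by (simp add: o_def j_def)
    have \<rho>jl: "(\<lambda>n. \<rho> (j (l n))) \<longlonglongrightarrow> 1"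
      using LIMSEQ_subseq_LIMSEQ[OF \<rho>k jl] by (simp add: o_def j_def)
    have ulimF: "uniform_limit K (\<lambda>n. F (j (l n))) p sequentially"
      if "compact K" "K \<subseteq> ball 0 1" for K
      using filterlim_compose[OF ulim[OF that] filterlim_subseq[OF jl]]
      by (simp add: o_def j_def)
    obtain d where d: "d > 0" "cball (p z) d \<subseteq> ball w e"
      using pz open_contains_cball open_ball by blast
    have spz: "s (p z) = z"
    proof -
      have "(\<lambda>n. S (l n) (F (j (l n)) z)) \<longlonglongrightarrow> s (p z)"
      proof (rule tendsto_uniform_limit_cball[where f = "\<lambda>n. S (l n)" and g = s and d = d])
        show "uniform_limit (cball (p z) d) (\<lambda>n. S (l n)) s sequentially"
          using ulims[OF _ d(2)] by (simp add: o_def)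
        show "continuous_on (cball (p z) d) s"
          using holomorphic_on_imp_continuous_on[OF hols] d(2) continuous_on_subset by blast
      qed (use Fjl[OF z] d in auto)
      moreover have "(\<lambda>n. of_real (\<rho> (j (l n))) * z) \<longlonglongrightarrow> of_real 1 * z"
        by (intro tendsto_intros \<rho>jl)
      ultimately show ?thesis
        unfolding Sz using LIMSEQ_unique by fastforce
    qed
    have s_le: "norm (s b) \<le> 1" if "b \<in> ball w e" for b
      using Lim_bounded[OF tendsto_norm[OF lims[OF that]]] S1[OF that] by (auto intro: less_imp_le)
    \<comment> \<open>A limit of maps into the disk could reach the circle. By the maximum modulus
      principle it would then be constant, but its value at \<open>p z\<close> is the interior point
      \<open>z\<close>.\<close>
    have s1: "norm (s b) < 1" if b: "b \<in> ball w e" for b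
    proof (rule ccontr)
      assume "\<not> norm (s b) < 1"
      then have "s constant_on ball w e"
        using s_le b by (intro maximum_modulus_principle[OF hols _ _ open_ball subset_refl b]) force+
      then have "s b = z"
        using b pz spz unfolding constant_on_def by metis
      then show False using \<open>\<not> norm (s b) < 1\<close> z by simp
    qed
    have psb: "p (s b) = b" if b: "b \<in> ball w e" for b
    proof -
      \<comment> \<open>Division undoes the shrinking, so that \<open>F\<close> takes the value
        \<open>b\<close> at \<open>T n\<close>. Early terms may lie outside the disk; only their
        limit \<open>s b\<close> has to lie inside.\<close>
      define T where "T n = S (l n) b / of_real (\<rho> (j (l n)))" for n
      have Tlim: "T \<longlonglongrightarrow> s b"
        using tendsto_divide[OF lims[OF b] tendsto_of_real[OF \<rho>jl]] by (simp add: T_def[abs_def])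
      obtain d where d: "d > 0" "cball (s b) d \<subseteq> ball 0 1"
        using s1[OF b] open_contains_cball_eq[OF open_ball] by (metis mem_ball_0)
      have "(\<lambda>n. F (j (l n)) (T n)) \<longlonglongrightarrow> p (s b)"
      proof (rule tendsto_uniform_limit_cball[where f = "\<lambda>n. F (j (l n))" and g = p and d = d])
        show "uniform_limit (cball (s b) d) (\<lambda>n. F (j (l n))) p sequentially"
          by (rule ulimF) (use d in auto)
        show "continuous_on (cball (s b) d) p"
          using holomorphic_on_imp_continuous_on[OF holp] d(2) continuous_on_subset by blast
      qed (use Tlim d in auto)
      moreover have "F (j (l n)) (T n) = b" for n
        using \<rho>[of "j (l n)"] PS[OF b] by (simp add: F_def T_def)
      ultimately show ?thesis by (simp add: LIMSEQ_const_iff)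
    qed
    show ?thesis
      using hols s1 spz psb by (intro exI[of _ s]) auto
  qed
  have p0: "p 0 = z0"
    using lim[of 0] P(2) by (simp add: F_def LIMSEQ_const_iff)
  \<comment> \<open>A section over a disc about \<open>z0\<close> forces \<open>p\<close> to take
    more than one value. Hurwitz's theorem requires this below.\<close>
  have nonconst: "\<not> p constant_on ball 0 1"
  proof
    assume c: "p constant_on ball 0 1"
    obtain e where e: "e > 0" "ball z0 e \<subseteq> G"
      using G openE by blast
    obtain s where s: "s ` ball z0 e \<subseteq> ball 0 1" "\<And>b. b \<in> ball z0 e \<Longrightarrow> p (s b) = b"
      using sec[OF e(2), of 0] p0 e by auto
    define b where "b = z0 + of_real (e/2)"
    have "b \<in> ball z0 e" "b \<noteq> z0" using e by (auto simp: b_def dist_norm)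
    moreover have "p (s b) = p 0"
      using c s(1) \<open>b \<in> ball z0 e\<close> unfolding constant_on_def
      by (metis centre_in_ball image_subset_iff zero_less_one)
    ultimately show False using s(2)[of b] p0 by simp
  qed
  have pG: "p z \<in> G" if z: "z \<in> ball 0 1" for z
  proof (rule ccontr)
    assume "p z \<notin> G"
    \<comment> \<open>The limit could a priori touch the boundary of \<open>G\<close>. The
      approximants omit \<open>p z\<close>, so Hurwitz's theorem would make the nonconstant limit
      omit it as well, which is absurd at \<open>z\<close>.\<close>
    have "p z - p z \<noteq> 0"
    proof (rule Hurwitz_no_zeros[of "ball 0 1" "\<lambda>n x. F (k n) x - p z" "\<lambda>x. p x - p z" z])
      show "(\<lambda>x. F (k n) x - p z) holomorphic_on ball 0 1" for n
        by (intro holomorphic_intros holF)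
      show "(\<lambda>x. p x - p z) holomorphic_on ball 0 1"
        by (intro holomorphic_intros holp)
      show "uniform_limit K (\<lambda>n x. F (k n) x - p z) (\<lambda>x. p x - p z) sequentially"
        if "compact K" "K \<subseteq> ball 0 1" for K
        using ulim[OF that] by (intro uniform_limit_intros) (simp add: o_def)
      show "\<not> (\<lambda>x. p x - p z) constant_on ball 0 1"
      proof
        assume "(\<lambda>x. p x - p z) constant_on ball 0 1"
        then obtain c where "\<And>x. x \<in> ball 0 1 \<Longrightarrow> p x - p z = c"
          unfolding constant_on_def by blast
        then have "\<And>x. x \<in> ball 0 1 \<Longrightarrow> p x = c + p z" by (simp add: algebra_simps)
        then show False using nonconst unfolding constant_on_def by blast
      qed
      show "F (k n) x - p z \<noteq> 0" if "x \<in> ball 0 1" for n x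
        using FG[OF that, of "k n"] \<open>p z \<notin> G\<close> by auto
    qed (use z in auto)
    then show False by simp
  qed
  show thesis
  proof (rule that[of p])
    show "lifts_discs p (ball 0 1) G"
      unfolding lifts_discs_def using holp pG sec by blast
  qed (rule p0)
qed

section \<open>From sections over discs to covering spaces\<close>

text \<open>A disc in \<open>G\<close> that meets the image lies in it, so the image is both open
  and closed in \<open>G\<close>.\<close>

lemma lifts_discs_imp_surj:
  assumes p: "lifts_discs p U G" and U: "U \<noteq> {}" and G: "open G" "connected G"
  shows "p ` U = G"
proof -
  have pG: "p ` U \<subseteq> G" using p by (simp add: lifts_discs_def)
  have ball: "ball w e \<subseteq> p ` U" if "ball w e \<subseteq> G" "p z \<in> ball w e" "z \<in> U" for w e z
    using lifts_discsE[OF p that(1,3,2)] by (metis image_eqI image_subset_iff subsetI)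
  have "openin (top_of_set G) (p ` U)"
  proof -
    have "open (p ` U)"
      unfolding open_contains_ball
    proof
      fix x assume x: "x \<in> p ` U"
      then obtain e where "e > 0" "ball x e \<subseteq> G"
        using pG G(1) openE by blast
      then show "\<exists>e>0. ball x e \<subseteq> p ` U"
        using ball x by (metis centre_in_ball image_iff)
    qed
    then show ?thesis using pG by (simp add: open_openin_trans G(1))
  qed
  moreover have "closedin (top_of_set G) (p ` U)"
    unfolding closedin_limpt
  proof (intro conjI allI impI pG)
    fix x assume x: "x islimpt p ` U \<and> x \<in> G"
    then obtain e where e: "e > 0" "ball x e \<subseteq> G"
      using G(1) openE by blast
    then obtain z where "z \<in> U" "p z \<in> ball x e"
      using x unfolding islimpt_approachable by (auto simp: dist_commute)
    then show "x \<in> p ` U"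
      using ball[OF e(2)] e by (metis centre_in_ball subsetD)
  qed
  ultimately show ?thesis
    using G(2) U unfolding connected_clopen by blast
qed

text \<open>The sheets over a disc are the images of all its holomorphic sections; these images are
  open, and they are disjoint or equal because sections meeting at a point coincide.\<close>

lemma lifts_discs_imp_covering_space:
  assumes p: "lifts_discs p U G" and U: "open U" "U \<noteq> {}" and G: "open G" "connected G"
  shows "covering_space U p G"
proof
  have holp: "p holomorphic_on U" using p by (simp add: lifts_discs_def)
  then show contp: "continuous_on U p" by (rule holomorphic_on_imp_continuous_on)
  show "p ` U = G" using lifts_discs_imp_surj assms by blast
  fix x assume "x \<in> G"
  then obtain e where e: "e > 0" "ball x e \<subseteq> G"
    using G(1) openE by blast
  let ?T = "ball x e"
  define sections where "sections = {s. s holomorphic_on ?T \<and> s ` ?T \<subseteq> U \<and> (\<forall>b\<in>?T. p (s b) = b)}"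
  have inj: "inj_on s ?T" if "s \<in> sections" for s
    using that by (auto simp: sections_def intro: inj_on_inverseI)
  have op: "open (s ` ?T)" if "s \<in> sections" for s
    using that inj[OF that] by (intro open_mapping_thm3) (auto simp: sections_def)
  have eq: "s b = t b" if st: "s \<in> sections" "t \<in> sections" and a: "a \<in> ?T" "s a = t a" and b: "b \<in> ?T"
    for s t a b
  proof -
    let ?E = "{b \<in> ?T. s b = t b}"
    have cont: "continuous_on ?T s" "continuous_on ?T t"
      using st by (auto simp: sections_def holomorphic_on_imp_continuous_on)
    \<comment> \<open>Since \<open>p\<close> inverts both sections, \<open>t c = s d\<close> forces
      \<open>c = d\<close>. The agreement set is thus the preimage of an open sheet.\<close>
    have "?E = ?T \<inter> t -` (s ` ?T)"
    proof (intro equalityI subsetI)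
      fix c assume "c \<in> ?T \<inter> t -` (s ` ?T)"
      then obtain d where "c \<in> ?T" "d \<in> ?T" "t c = s d" by auto
      moreover from this have "p (t c) = c" "p (s d) = d" using st unfolding sections_def by blast+
      ultimately show "c \<in> ?E" by auto
    qed (auto intro: rev_image_eqI)
    moreover have "openin (top_of_set ?T) (?T \<inter> t -` (s ` ?T))"
      using continuous_openin_preimage_gen cont(2) op st(1) by blast
    ultimately have "openin (top_of_set ?T) ?E" by simp
    moreover have "closedin (top_of_set ?T) ?E"
    proof -
      have "?E = {b \<in> ?T. s b - t b = 0}" by simp
      then show ?thesis
        using continuous_closedin_preimage_constant[OF continuous_on_diff[OF cont], of 0] by (simp only:)
    qed
    ultimately have "?E = ?T"
      using a connected_ball[of x e] unfolding connected_clopen by blast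
    then show ?thesis using b by blast
  qed
  show "\<exists>T. x \<in> T \<and> openin (top_of_set G) T \<and>
          (\<exists>v. \<Union>v = U \<inter> p -` T \<and> (\<forall>u\<in>v. openin (top_of_set U) u) \<and>
               pairwise disjnt v \<and> (\<forall>u\<in>v. \<exists>q. homeomorphism u T p q))"
  proof (intro exI[of _ ?T] conjI exI[of _ "(\<lambda>s. s ` ?T) ` sections"])
    show "openin (top_of_set G) ?T"
      using e(2) by (simp add: open_openin_trans G(1))
    show "\<Union> ((\<lambda>s. s ` ?T) ` sections) = U \<inter> p -` ?T"
    proof (intro equalityI subsetI)
      fix z assume "z \<in> U \<inter> p -` ?T"
      then have z: "z \<in> U" "p z \<in> ?T" by auto
      obtain s where "s \<in> sections" "s (p z) = z"
        by (rule lifts_discsE[OF p e(2) z]) (auto simp: sections_def simp del: mem_ball)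
      then show "z \<in> \<Union> ((\<lambda>s. s ` ?T) ` sections)"
        using z(2) by (metis UN_I image_eqI)
    qed (auto simp: sections_def)
    show "\<forall>u\<in>(\<lambda>s. s ` ?T) ` sections. openin (top_of_set U) u"
    proof clarify
      fix s assume s: "s \<in> sections"
      then have "s ` ?T \<subseteq> U" by (simp add: sections_def)
      then show "openin (top_of_set U) (s ` ?T)"
        using op[OF s] U(1) by (simp add: open_openin_trans)
    qed
    show "pairwise disjnt ((\<lambda>s. s ` ?T) ` sections)"
    proof (clarsimp simp: pairwise_def)
      fix s t assume st: "s \<in> sections" "t \<in> sections" and ne: "s ` ?T \<noteq> t ` ?T"
      show "disjnt (s ` ?T) (t ` ?T)"
      proof (rule ccontr)
        assume "\<not> disjnt (s ` ?T) (t ` ?T)"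
        then obtain a b where ab: "a \<in> ?T" "b \<in> ?T" "s a = t b" by (auto simp: disjnt_iff)
        then have "p (s a) = a" "p (t b) = b" using st unfolding sections_def by blast+
        then have "a = b" using ab by simp
        then have "s ` ?T = t ` ?T"
          using eq[OF st ab(1)] ab by (intro image_cong) auto
        then show False using ne by simp
      qed
    qed
    show "\<forall>u\<in>(\<lambda>s. s ` ?T) ` sections. \<exists>q. homeomorphism u ?T p q"
    proof clarify
      fix s assume s: "s \<in> sections"
      then have "homeomorphism (s ` ?T) ?T p s"
        unfolding homeomorphism_def sections_def
        using continuous_on_subset[OF contp] holomorphic_on_imp_continuous_on
        by (auto simp: image_image)
      then show "\<exists>q. homeomorphism (s ` ?T) ?T p q" by blast
    qed
  qed (use e in auto)
qed

theorem exists_holomorphic_universal_cover: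
  assumes "open G" "bounded G" "connected G" "G \<noteq> {}"
  obtains p where "holomorphic_universal_cover p G"
proof -
  obtain z0 where "z0 \<in> G" using assms by blast
  then obtain p where p: "lifts_discs p (ball 0 1) G"
    using exists_lifts_discs_disc assms by metis
  then have "holomorphic_universal_cover p G"
    using lifts_discs_imp_covering_space[OF p] assms
    by (auto simp: holomorphic_universal_cover_def lifts_discs_def)
  then show thesis by (rule that)
qed

section \<open>Contraction of the hyperbolic density\<close>

text \<open>Disk automorphisms moving \<open>z\<close> and \<open>h z\<close> to 0 reduce both
  claims to the Schwarz lemma. Equality makes the conjugated map a rotation; surjectivity of
  \<open>h\<close> is the consequence that later identifies domains.\<close>

lemma Schwarz_Pick:
  assumes h: "h holomorphic_on ball 0 1" "h ` ball 0 1 \<subseteq> ball 0 1" and z: "norm z < 1"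
  shows "disk_density (h z) * norm (deriv h z) \<le> disk_density z"
    and "disk_density (h z) * norm (deriv h z) = disk_density z \<Longrightarrow> h ` ball 0 1 = ball 0 1"
proof -
  let ?M = "Moebius_function 0"
  let ?w = "h z"
  have w: "norm ?w < 1" using h(2) z by (meson image_subset_iff mem_ball_0)
  have hol: "?M w holomorphic_on ball 0 1" if "norm w < 1" for w
    using that by (rule Moebius_function_holomorphic)
  have M1: "norm (?M w z) < 1" if "norm w < 1" "norm z < 1" for w z
    using that by (rule Moebius_function_norm_lt_1)
  have MM: "?M (-w) (?M w x) = x" if "norm w < 1" "norm x < 1" for w x
    using that by (intro Moebius_function_compose) auto
  have h1: "norm (h u) < 1" if "norm u < 1" for u
    using h(2) that by (meson image_subset_iff mem_ball_0)
  define k where "k u = ?M ?w (h (?M (-z) u))" for u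
  have holk: "k holomorphic_on ball 0 1"
    unfolding k_def using M1 z w h1
    by (intro holomorphic_on_compose_gen[OF _ hol[of ?w], unfolded o_def]
          holomorphic_on_compose_gen[OF hol[of "-z"] h(1), unfolded o_def]) auto
  have k0: "k 0 = 0" by (simp add: k_def Moebius_function_simple)
  have k1: "norm (k u) < 1" if "norm u < 1" for u
    unfolding k_def using that M1 z w h1 by auto
  have d1: "(?M (-z) has_field_derivative of_real (1 - (norm z)\<^sup>2)) (at 0)"
    using Moebius_function_0_has_field_derivative[of "-z" 0] z by simp
  have d2: "(h has_field_derivative deriv h z) (at (?M (-z) 0))"
    using holomorphic_derivI[OF h(1)] z by (simp add: Moebius_function_simple)
  have "1 - cnj ?w * ?w = of_real (1 - (norm ?w)\<^sup>2)"
    by (simp add: complex_norm_square mult.commute flip: of_real_power)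
  moreover have pos: "1 - (norm ?w)\<^sup>2 > 0" "1 - (norm z)\<^sup>2 > 0"
    using w z by (auto simp: power_less_one_iff)
  ultimately have d3: "(?M ?w has_field_derivative of_real (1 / (1 - (norm ?w)\<^sup>2)))
      (at (h (?M (-z) 0)))"
    using Moebius_function_0_has_field_derivative[OF w w]
    by (simp add: Moebius_function_simple power2_eq_square del: of_real_mult of_real_diff of_real_power)
  have "deriv k 0 = of_real (1 / (1 - (norm ?w)\<^sup>2)) * (deriv h z * of_real (1 - (norm z)\<^sup>2))"
    unfolding k_def
    using DERIV_chain2[where f = "?M ?w" and g = "\<lambda>u. h (?M (-z) u)", OF d3 DERIV_chain2[OF d2 d1]]
    by (rule DERIV_imp_deriv)
  then have "norm (deriv k 0) = disk_density ?w * (norm (deriv h z) * (1 - (norm z)\<^sup>2))"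
    using pos by (simp add: norm_mult disk_density_def norm_divide
        del: of_real_mult of_real_diff of_real_power)
  then have dk: "disk_density ?w * norm (deriv h z) = norm (deriv k 0) * disk_density z"
    using pos by (simp add: disk_density_def)
  have dz: "disk_density z > 0" using pos by (simp add: disk_density_def)
  have S: "norm (deriv k 0) \<le> 1"
    using Schwarz_Lemma(2)[OF holk k0 k1, of 0] by simp
  show "disk_density (h z) * norm (deriv h z) \<le> disk_density z"
    unfolding dk using S dz by (simp add: mult_left_le_one_le)
  show "h ` ball 0 1 = ball 0 1" if "disk_density (h z) * norm (deriv h z) = disk_density z"
  proof -
    have "norm (deriv k 0) = 1" using that dk dz by simp
    then obtain \<alpha> where \<alpha>: "\<And>u. norm u < 1 \<Longrightarrow> k u = \<alpha> * u" "norm \<alpha> = 1"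
      using Schwarz_Lemma(3)[OF holk k0 k1, of 0] by auto
    have "y \<in> h ` ball 0 1" if y: "norm y < 1" for y
    proof -
      \<comment> \<open>This solves \<open>\<alpha> * u = ?M ?w y\<close>; undoing the automorphisms
        turns it into a preimage of \<open>y\<close> under \<open>h\<close>.\<close>
      define u where "u = ?M ?w y / \<alpha>"
      have u: "norm u < 1" using M1[OF w y] \<alpha>(2) by (simp add: u_def norm_divide)
      have "k u = ?M ?w y"
        using \<alpha> u by (auto simp: u_def)
      then have "?M (- ?w) (?M ?w (h (?M (-z) u))) = ?M (- ?w) (?M ?w y)"
        by (simp add: k_def)
      then have "h (?M (-z) u) = y"
        using MM[OF w h1] MM[OF w y] M1[of "-z" u] z u by simp
      then show ?thesis using M1[of "-z" u] z u by force
    qed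
    then show ?thesis using h(2) by auto
  qed
qed

text \<open>A covering map is locally injective, and an injective holomorphic map has nonvanishing
  derivative.\<close>

lemma deriv_holomorphic_universal_cover_nonzero:
  assumes p: "holomorphic_universal_cover p G" and x: "x \<in> ball 0 1"
  shows "deriv p x \<noteq> 0"
proof -
  have cov: "covering_space (ball 0 1) p G" and hol: "p holomorphic_on ball 0 1"
    using p by (auto simp: holomorphic_universal_cover_def)
  obtain T u q where "x \<in> T" "openin (top_of_set (ball 0 1)) T" "homeomorphism T u p q"
    using covering_space_local_homeomorphism[OF cov x] by metis
  moreover from this have "open T" "T \<subseteq> ball 0 1"
    by (auto simp: openin_open_eq)
  ultimately show ?thesis
    using holomorphic_injective_imp_regular[of p T x] hol
    by (meson holomorphic_on_subset homeomorphism_def inj_on_inverseI)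
qed

lemma disk_density_pos: "norm x < 1 \<Longrightarrow> disk_density x > 0"
  by (simp add: disk_density_def power_less_one_iff)

text \<open>Lifting \<open>f\<close> through \<open>q\<close> gives a holomorphic self-map of the
  disk sending \<open>x\<close> to \<open>y\<close>, to which Schwarz-Pick applies. Equality makes
  the lift onto, hence \<open>f\<close> maps onto \<open>H\<close>.\<close>

lemma density_contraction:
  assumes q: "holomorphic_universal_cover q H"
    and f: "f holomorphic_on ball 0 1" "f ` ball 0 1 \<subseteq> H"
    and x: "x \<in> ball 0 1" and y: "y \<in> ball 0 1" and eq: "f x = q y"
  shows "disk_density y * norm (deriv f x) \<le> disk_density x * norm (deriv q y)"
    and "disk_density y * norm (deriv f x) = disk_density x * norm (deriv q y) \<Longrightarrow> f ` ball 0 1 = H"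
proof -
  have cov: "covering_space (ball 0 1) q H" and hol: "q holomorphic_on ball 0 1"
    using q by (auto simp: holomorphic_universal_cover_def)
  obtain h where h: "continuous_on (ball 0 1) h" "h \<in> ball 0 1 \<rightarrow> ball 0 1" "h x = y"
    "\<And>u. u \<in> ball 0 1 \<Longrightarrow> q (h u) = f u"
  proof (rule covering_space_lift_strong[where f = f, OF cov y x])
    show "simply_connected (ball 0 1 :: complex set)" "locally path_connected (ball 0 1 :: complex set)"
      by (auto intro: convex_imp_simply_connected open_imp_locally_path_connected)
  qed (use f eq holomorphic_on_imp_continuous_on in auto)
  have holh: "h holomorphic_on ball 0 1"
    using covering_space_lift_is_holomorphic[OF cov open_ball hol f(1) _ h(2,1,4)] f(2) by blast
  have him: "h ` ball 0 1 \<subseteq> ball 0 1" using h(2) by blast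
  have "(q has_field_derivative deriv q y) (at (h x))" "(h has_field_derivative deriv h x) (at x)"
    using holomorphic_derivI hol holh x y h(3) by auto
  then have "((\<lambda>u. q (h u)) has_field_derivative deriv q y * deriv h x) (at x)"
    by (rule DERIV_chain2)
  then have "(f has_field_derivative deriv q y * deriv h x) (at x)"
    by (rule has_field_derivative_transform_within_open[OF _ open_ball x]) (rule h(4))
  then have df: "norm (deriv f x) = norm (deriv q y) * norm (deriv h x)"
    by (simp add: DERIV_imp_deriv norm_mult)
  have nz: "norm (deriv q y) > 0"
    using deriv_holomorphic_universal_cover_nonzero[OF q y] by simp
  have SP: "disk_density y * norm (deriv h x) \<le> disk_density x"
    "disk_density y * norm (deriv h x) = disk_density x \<Longrightarrow> h ` ball 0 1 = ball 0 1"
    using Schwarz_Pick[OF holh him, of x] x h(3) by auto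
  show "disk_density y * norm (deriv f x) \<le> disk_density x * norm (deriv q y)"
    using mult_right_mono[OF SP(1), of "norm (deriv q y)"] unfolding df by (simp add: ac_simps)
  assume "disk_density y * norm (deriv f x) = disk_density x * norm (deriv q y)"
  then have "norm (deriv q y) * (disk_density y * norm (deriv h x)) = norm (deriv q y) * disk_density x"
    unfolding df by (simp add: ac_simps)
  then have "h ` ball 0 1 = ball 0 1"
    using nz by (intro SP(2)) simp
  moreover have "f ` ball 0 1 = q ` h ` ball 0 1"
    using h(4) by (simp add: image_image)
  ultimately show "f ` ball 0 1 = H"
    using covering_space_imp_surjective[OF cov] by simp
qed

section \<open>Well-definedness and monotonicity of the hyperbolic density\<close>

text \<open>Each cover contracts against the other, so both inequalities hold.\<close>

lemma universal_cover_density_unique: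
  assumes p: "holomorphic_universal_cover p G" and q: "holomorphic_universal_cover q G"
    and x: "x \<in> ball 0 1" and y: "y \<in> ball 0 1" and eq: "p x = q y"
  shows "disk_density x / norm (deriv p x) = disk_density y / norm (deriv q y)"
proof -
  have "p holomorphic_on ball 0 1" "p ` ball 0 1 \<subseteq> G" "q holomorphic_on ball 0 1" "q ` ball 0 1 \<subseteq> G"
    using p q covering_space_imp_surjective by (auto simp: holomorphic_universal_cover_def)
  then have "disk_density y * norm (deriv p x) = disk_density x * norm (deriv q y)"
    using density_contraction(1)[where f = p, OF q _ _ x y eq]
      density_contraction(1)[where f = q, OF p _ _ y x eq[symmetric]]
    by (intro antisym) auto
  then show ?thesis
    using deriv_holomorphic_universal_cover_nonzero[OF p x] deriv_holomorphic_universal_cover_nonzero[OF q y]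
    by (simp add: field_simps)
qed

lemma hyperbolic_density_eq:
  assumes p: "holomorphic_universal_cover p G" and x: "x \<in> ball 0 1"
  shows "hyperbolic_density G (p x) = disk_density x / norm (deriv p x)"
  unfolding hyperbolic_density_def
proof (rule the_equality)
  let ?r = "disk_density x / norm (deriv p x)"
  \<comment> \<open>The choice of a preimage is harmless:
    \<open>universal_cover_density_unique\<close> with both covers equal to \<open>p\<close> shows
    that the value does not depend on it.\<close>
  define l where "l z = (let y = (SOME y. y \<in> ball 0 1 \<and> p y = z) in disk_density y / norm (deriv p y))" for z
  have l: "l (p y) = disk_density y / norm (deriv p y)" if "y \<in> ball 0 1" for y
  proof -
    have "\<exists>y'. y' \<in> ball 0 1 \<and> p y' = p y" using that by blast
    from someI_ex[OF this] show ?thesis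
      unfolding l_def Let_def using universal_cover_density_unique[OF p p _ that] by blast
  qed
  have "is_hyperbolic_density G l"
    unfolding is_hyperbolic_density_def
    using p l deriv_holomorphic_universal_cover_nonzero[OF p] by (intro exI[of _ p]) auto
  then show "\<exists>l. is_hyperbolic_density G l \<and> l (p x) = ?r"
    using l[OF x] by blast
  fix r assume "\<exists>l. is_hyperbolic_density G l \<and> l (p x) = r"
  then obtain l q where q: "holomorphic_universal_cover q G"
    and lq: "\<And>y. y \<in> ball 0 1 \<Longrightarrow> l (q y) * norm (deriv q y) = disk_density y" and r: "l (p x) = r"
    unfolding is_hyperbolic_density_def by blast
  have "p x \<in> q ` ball 0 1"
    using p q x covering_space_imp_surjective unfolding holomorphic_universal_cover_def by blast
  then obtain y where y: "y \<in> ball 0 1" "p x = q y" by blast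
  then have "r = disk_density y / norm (deriv q y)"
    using lq[OF y(1)] r deriv_holomorphic_universal_cover_nonzero[OF q y(1)] by (simp add: field_simps)
  then show "r = ?r"
    using universal_cover_density_unique[OF p q x y] by simp
qed

lemma hyperbolic_density_coverE:
  assumes G: "open G" "bounded G" "connected G" "z \<in> G"
  obtains p x where "holomorphic_universal_cover p G" "x \<in> ball 0 1" "p x = z"
    "hyperbolic_density G z = disk_density x / norm (deriv p x)" "0 < norm (deriv p x)"
proof -
  obtain p where p: "holomorphic_universal_cover p G"
    using exists_holomorphic_universal_cover[of G] G by blast
  then have "z \<in> p ` ball 0 1"
    using covering_space_imp_surjective G(4) unfolding holomorphic_universal_cover_def by blast
  then obtain x where "x \<in> ball 0 1" "p x = z" by blast
  then show thesis
    using that[OF p] hyperbolic_density_eq[OF p] deriv_holomorphic_universal_cover_nonzero[OF p] by auto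
qed

lemma hyperbolic_density_pos:
  assumes "open G" "bounded G" "connected G" "z \<in> G"
  shows "hyperbolic_density G z > 0"
  using hyperbolic_density_coverE[OF assms] disk_density_pos
  by (metis divide_pos_pos mem_ball_0)

text \<open>A cover of \<open>G\<close> is also a map of the disk into \<open>H\<close>, so
  \<open>density_contraction\<close> applies. In the equality case its image is both
  \<open>G\<close> and \<open>H\<close>.\<close>

lemma hyperbolic_density_antimono:
  assumes G: "open G" "connected G" "z \<in> G" and H: "open H" "bounded H" "connected H" and GH: "G \<subseteq> H"
  shows "hyperbolic_density H z \<le> hyperbolic_density G z"
    and "hyperbolic_density H z = hyperbolic_density G z \<Longrightarrow> G = H"
proof -
  have "bounded G" "z \<in> H" using assms bounded_subset by auto
  obtain p x where p: "holomorphic_universal_cover p G" "x \<in> ball 0 1" "p x = z"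
    "hyperbolic_density G z = disk_density x / norm (deriv p x)" "0 < norm (deriv p x)"
    using hyperbolic_density_coverE[OF G(1) \<open>bounded G\<close> G(2,3)] by blast
  obtain q y where q: "holomorphic_universal_cover q H" "y \<in> ball 0 1" "q y = z"
    "hyperbolic_density H z = disk_density y / norm (deriv q y)" "0 < norm (deriv q y)"
    using hyperbolic_density_coverE[OF H \<open>z \<in> H\<close>] by blast
  have pG: "p holomorphic_on ball 0 1" "p ` ball 0 1 = G"
    using p(1) covering_space_imp_surjective by (auto simp: holomorphic_universal_cover_def)
  note D = density_contraction[OF q(1) pG(1) _ p(2) q(2)]
  show "hyperbolic_density H z \<le> hyperbolic_density G z"
    unfolding p(4) q(4) using D(1) pG(2) GH p(3,5) q(3,5) by (simp add: field_simps)
  assume "hyperbolic_density H z = hyperbolic_density G z"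
  then have "disk_density y * norm (deriv p x) = disk_density x * norm (deriv q y)"
    unfolding p(4) q(4) using p(5) q(5) by (simp add: field_simps)
  then show "G = H"
    using D(2) pG(2) GH p(3) q(3) by simp
qed

section \<open>The sharp bound for the quotient\<close>

lemma density_quotient_ge_half:
  assumes D: "D1 \<in> hyperbolic_class R" "D2 \<in> hyperbolic_class R" and z: "z \<in> D1 \<inter> D2"
  shows "1 / 2 \<le> density_quotient D1 D2 z"
    and "density_quotient D1 D2 z = 1 / 2 \<longleftrightarrow> D1 = D2"
proof -
  let ?C = "connected_component_set (D1 \<inter> D2) z"
  have D': "open D1" "connected D1" "bounded D1" "open D2" "connected D2" "bounded D2"
    using D bounded_subset[OF bounded_ball]
    by (auto simp: hyperbolic_class_def hyperbolic_domain_def plane_domain_def)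
  have C: "open ?C" "connected ?C" "z \<in> ?C" "?C \<subseteq> D1" "?C \<subseteq> D2"
    using D' z connected_component_subset[of "D1 \<inter> D2" z]
    by (auto simp: open_connected_component open_Int connected_component_refl)
  note mono1 = hyperbolic_density_antimono[OF C(1-3) D'(1,3,2) C(4)]
  note mono2 = hyperbolic_density_antimono[OF C(1-3) D'(4,6,5) C(5)]
  have pos: "hyperbolic_density D1 z > 0" "hyperbolic_density D2 z > 0"
    using hyperbolic_density_pos D' z by auto
  show "1 / 2 \<le> density_quotient D1 D2 z"
    unfolding density_quotient_def using pos mono1(1) mono2(1) by (simp add: field_simps)
  show "density_quotient D1 D2 z = 1 / 2 \<longleftrightarrow> D1 = D2"
  proof
    assume "density_quotient D1 D2 z = 1 / 2"
    then have "2 * hyperbolic_density ?C z = hyperbolic_density D1 z + hyperbolic_density D2 z"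
      unfolding density_quotient_def using pos by (simp add: field_simps)
    \<comment> \<open>Neither density exceeds that of the component, yet their sum is twice it, so
      both are equal to it.\<close>
    then have "hyperbolic_density D1 z = hyperbolic_density ?C z"
      "hyperbolic_density D2 z = hyperbolic_density ?C z"
      using mono1(1) mono2(1) by linarith+
    from mono1(2)[OF this(1)] mono2(2)[OF this(2)] show "D1 = D2" by (rule trans[OF sym])
  next
    assume "D1 = D2"
    moreover from this have "?C = D1"
      using D' z by (simp add: connected_component_eq_self)
    ultimately show "density_quotient D1 D2 z = 1 / 2"
      unfolding density_quotient_def using pos by simp
  qed
qed

lemma ball_in_sc_class:
  assumes "R > 0"
  shows "ball 0 R \<in> sc_class R"
proof -
  have "(\<exists>a b :: complex. a \<noteq> b \<and> a \<notin> ball 0 R \<and> b \<notin> ball 0 R)"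
    using assms by (intro exI[of _ "of_real R"] exI[of _ "- of_real R"]) auto
  then show ?thesis
    using assms convex_imp_simply_connected[OF convex_ball]
    by (auto simp: sc_class_def hyperbolic_class_def hyperbolic_domain_def plane_domain_def)
qed

theorem theorem1p4:
  fixes R :: real
  assumes "R > 0"
  shows "B_gen R = 1 / 2 \<and> B_sc R = 1 / 2 \<and>
    (\<exists>D1\<in>hyperbolic_class R. \<exists>D2\<in>hyperbolic_class R. \<exists>z\<in>D1 \<inter> D2.
       density_quotient D1 D2 z = B_gen R) \<and>
    (\<exists>D1\<in>sc_class R. \<exists>D2\<in>sc_class R. \<exists>z\<in>D1 \<inter> D2.
       density_quotient D1 D2 z = B_sc R) \<and>
    (\<forall>D1\<in>hyperbolic_class R. \<forall>D2\<in>hyperbolic_class R. \<forall>z\<in>D1 \<inter> D2.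
       density_quotient D1 D2 z = 1 / 2 \<longleftrightarrow> D1 = D2) \<and>
    (\<forall>D1\<in>sc_class R. \<forall>D2\<in>sc_class R. \<forall>z\<in>D1 \<inter> D2.
       density_quotient D1 D2 z = 1 / 2 \<longleftrightarrow> D1 = D2)"
proof -
  let ?D = "ball 0 R :: complex set"
  have sub: "sc_class R \<subseteq> hyperbolic_class R" by (auto simp: sc_class_def)
  have D: "?D \<in> sc_class R" "?D \<in> hyperbolic_class R" "0 \<in> ?D \<inter> ?D"
    using ball_in_sc_class assms sub by auto
  have Q: "density_quotient ?D ?D 0 = 1 / 2"
    using density_quotient_ge_half(2)[OF D(2,2,3)] by simp
  \<comment> \<open>One argument serves both classes, since \<open>?D\<close> lies in each and,
    paired with itself, attains the bound.\<close>
  have inf: "Inf {density_quotient D1 D2 z | D1 D2 z. D1 \<in> \<C> \<and> D2 \<in> \<C> \<and> z \<in> D1 \<inter> D2} = 1 / 2"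
    if "\<C> \<subseteq> hyperbolic_class R" "?D \<in> \<C>" for \<C>
  proof (rule cInf_eq_minimum)
    show "1 / 2 \<in> {density_quotient D1 D2 z | D1 D2 z. D1 \<in> \<C> \<and> D2 \<in> \<C> \<and> z \<in> D1 \<inter> D2}"
      using that(2) D(3) Q[symmetric] by blast
  qed (use that(1) density_quotient_ge_half(1) in blast)
  have B: "B_gen R = 1 / 2" "B_sc R = 1 / 2"
    unfolding B_gen_def B_sc_def using inf[OF order_refl D(2)] inf[OF sub D(1)] .
  have ex: "\<exists>D1\<in>\<C>. \<exists>D2\<in>\<C>. \<exists>z\<in>D1 \<inter> D2. density_quotient D1 D2 z = 1 / 2"
    if "?D \<in> \<C>" for \<C>
    using that D(3) Q by blast
  have eq: "\<forall>D1\<in>\<C>. \<forall>D2\<in>\<C>. \<forall>z\<in>D1 \<inter> D2. density_quotient D1 D2 z = 1 / 2 \<longleftrightarrow> D1 = D2"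
    if "\<C> \<subseteq> hyperbolic_class R" for \<C>
    using that density_quotient_ge_half(2) by blast
  show ?thesis
    unfolding B by (intro conjI refl ex[OF D(2)] ex[OF D(1)] eq[OF order_refl] eq[OF sub])
qed

end
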